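(* Let $\bar\triangle=\{\Delta_1,\dots,\Delta_n\}$ be a strip of $n$ triangles with vertices $V_1,\dots,V_{n+2}$ and let $\{\bar\triangle,\mathcal A\}$ be an exact problem (i.e. $\mathcal A\subset|\bar\triangle|$ consists of exactly $n+2$ nodes). Let $1\le k\le n-2$ and assume that the subproblem $\{\bar\triangle_k^{k+2},\mathcal A_k^{k+2}\}$ is basic of type "$2+1+2/B$". Then the problem $\{\bar\triangle,\mathcal A\}$ is poised if and only if both of the following reduced problems are exact and poised: $$\Big\{\bar\triangle_1^{k-1},\ \mathcal A_1^{k-1}\cup\{V_k,V_{k+1}\}\Big\},\qquad \Big\{\bar\triangle_{k+3}^{n},\ \mathcal A_{k+3}^{n}\cup\{V_{k+3},V_{k+4}\}\Big\}.$$ Here if $k=1$ the first reduced problem is absent (no condition), and if $k=n-2$ the second reduced problem is absent (no condition).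
   Context: A strip of triangles: $n\ge1$ and $V_1,\dots,V_{n+2}$ are points in the plane such that the closed triangles $\Delta_i=[V_i,V_{i+1},V_{i+2}]$, $i=1,\dots,n$, are nondegenerate and: $\Delta_i\cap\Delta_{i+1}$ is exactly the common side $[V_{i+1},V_{i+2}]$; $\Delta_i\cap\Delta_{i+2}=\{V_{i+2}\}$; all other pairs of distinct triangles are disjoint. The strip is $\bar\triangle=\{\Delta_1,\dots,\Delta_n\}$ and $|\bar\triangle|=\bigcup_{i=1}^n\Delta_i$. For $1\le i\le j\le n$, $\bar\triangle_i^j=\{\Delta_i,\dots,\Delta_j\}$, itself a strip, $|\bar\triangle_i^j|$ is the union of its triangles, and $\mathcal A_i^j=\mathcal A\cap|\bar\triangle_i^j|$ is the set of all nodes of $\mathcal A$ lying in it. $S(\bar\triangle)$ is the linear space of continuous functions $s:|\bar\triangle|\to\mathbb R$ whose restriction to each $\Delta_i$ is a polynomial of total degree at most $1$ in two variables. For a finite set of (distinct) nodes $\mathcal A=\{A_1,\dots,A_M\}\subset|\bar\triangle|$, the interpolation problem $\{\bar\triangle,\mathcal A\}$ is poised if for all real $c_1,\dots,c_M$ there is exactly one $s\in S(\bar\triangle)$ with $s(A_i)=c_i$ for all $i$. For a strip of $n$ triangles the problem is exact if $\#\mathcal A=n+2$; the same terminology is used for substrips, with $n$ replaced by their number of triangles. A problem is basic of type "$2+1+2/B$" if its strip consists of three triangles, the first and the last triangle each contain exactly two nodes, the middle triangle contains exactly one node, and the line passing through the two nodes in each of the first and the last triangles does not intersect the neighboring (middle)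 triangle. (In particular no node lies on a common side of two neighboring triangles of this three-triangle strip.)
   Formalization: The "only if" direction is proved assuming no node lies in the relative interior of [V_k,V_{k+1}] (when k>1) or of [V_{k+3},V_{k+4}] (when k<n-2); without this it is false, since the reduced problem need not be exact. The "if" direction needs no such assumption. *)

theory Defs
  imports "HOL-Analysis.Analysis"
begin

text \<open>
  The vertices of a strip are the values \<open>V 1, V 2, \<dots>\<close> of a function on the naturals (only
  \<open>V 1, \<dots>, V (n + 2)\<close> matter for a strip of \<open>n\<close> triangles). The substrip consisting of the
  triangles with indices \<open>i, \<dots>, j\<close> is represented by \<open>V\<close> together with the bounds \<open>i\<close> and \<open>j\<close>.
\<close>

type_synonym point = "real ^ 2"

definition tri :: "(nat \<Rightarrow> point) \<Rightarrow> nat \<Rightarrow> point set" where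
  "tri V i = convex hull {V i, V (i + 1), V (i + 2)}"

definition is_strip :: "(nat \<Rightarrow> point) \<Rightarrow> nat \<Rightarrow> bool" where
  "is_strip V n \<longleftrightarrow>
     1 \<le> n \<and>
     (\<forall>i. 1 \<le> i \<and> i \<le> n \<longrightarrow> \<not> collinear {V i, V (i + 1), V (i + 2)}) \<and>
     (\<forall>i. 1 \<le> i \<and> i + 1 \<le> n \<longrightarrow>
        tri V i \<inter> tri V (i + 1) = closed_segment (V (i + 1)) (V (i + 2))) \<and>
     (\<forall>i. 1 \<le> i \<and> i + 2 \<le> n \<longrightarrow> tri V i \<inter> tri V (i + 2) = {V (i + 2)}) \<and>
     (\<forall>i j. 1 \<le> i \<and> i + 3 \<le> j \<and> j \<le> n \<longrightarrow> tri V i \<inter> tri V j = {})"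

definition region :: "(nat \<Rightarrow> point) \<Rightarrow> nat \<Rightarrow> nat \<Rightarrow> point set" where
  "region V i j = (\<Union>m\<in>{i..j}. tri V m)"

definition nodes_in :: "point set \<Rightarrow> (nat \<Rightarrow> point) \<Rightarrow> nat \<Rightarrow> nat \<Rightarrow> point set" where
  "nodes_in A V i j = A \<inter> region V i j"

text \<open>
  Splines are functions on the region only; membership in \<open>extensional\<close> fixes their values
  elsewhere, so that equality of functions is equality on the region.
\<close>

definition spline_space :: "(nat \<Rightarrow> point) \<Rightarrow> nat \<Rightarrow> nat \<Rightarrow> (point \<Rightarrow> real) set" where
  "spline_space V i j =
     {s \<in> extensional (region V i j).
        continuous_on (region V i j) s \<and>
        (\<forall>m\<in>{i..j}. \<exists>a b c. \<forall>p\<in>tri V m. s p = a + b * p $ 1 + c * p $ 2)}"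

definition poised :: "(nat \<Rightarrow> point) \<Rightarrow> nat \<Rightarrow> nat \<Rightarrow> point set \<Rightarrow> bool" where
  "poised V i j A \<longleftrightarrow>
     (\<forall>c :: point \<Rightarrow> real. \<exists>!s. s \<in> spline_space V i j \<and> (\<forall>a\<in>A. s a = c a))"

definition exact :: "(nat \<Rightarrow> point) \<Rightarrow> nat \<Rightarrow> nat \<Rightarrow> point set \<Rightarrow> bool" where
  "exact V i j A \<longleftrightarrow> finite A \<and> A \<subseteq> region V i j \<and> card A = card {i..j} + 2"

text \<open>
  The problem with node set \<open>B\<close> on the triangles \<open>k, k + 1, k + 2\<close>. The affine hull of a
  two-element set is the line through its elements.
\<close>

definition basic_212B :: "(nat \<Rightarrow> point) \<Rightarrow> nat \<Rightarrow> point set \<Rightarrow> bool" where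
  "basic_212B V k B \<longleftrightarrow>
     B \<subseteq> region V k (k + 2) \<and>
     card (B \<inter> tri V k) = 2 \<and>
     card (B \<inter> tri V (k + 1)) = 1 \<and>
     card (B \<inter> tri V (k + 2)) = 2 \<and>
     affine hull (B \<inter> tri V k) \<inter> tri V (k + 1) = {} \<and>
     affine hull (B \<inter> tri V (k + 2)) \<inter> tri V (k + 1) = {}"

text \<open>
  For \<open>1 < k\<close> the first triangle of the basic substrip shares the side \<open>[V k, V (k + 1)]\<close> with
  its predecessor, and for \<open>k + 2 < n\<close> the last one shares \<open>[V (k + 3), V (k + 4)]\<close> with its
  successor. A node in the relative interior of such a side would be counted in the reduced
  problem as well, where it is collinear with the two added vertices, so that the reduced problem
  is not poised even when the original problem is. Example with \<open>n = 4\<close>, \<open>k = 2\<close>: vertices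
  \<open>(1,1), (2,0), (3,1), (4,0), (5,1), (6,0)\<close> and nodes
  \<open>(1,1), (5/2,1/2), (3,0), (4,1/2), (5,0), (11/2,1/2)\<close>.
  The end points of the sides are allowed as nodes.
\<close>

definition no_inner_side_nodes :: "(nat \<Rightarrow> point) \<Rightarrow> nat \<Rightarrow> nat \<Rightarrow> point set \<Rightarrow> bool" where
  "no_inner_side_nodes V n k A \<longleftrightarrow>
     (1 < k \<longrightarrow> A \<inter> open_segment (V k) (V (k + 1)) = {}) \<and>
     (k + 2 < n \<longrightarrow> A \<inter> open_segment (V (k + 3)) (V (k + 4)) = {})"

text \<open>A reduced problem on an empty substrip imposes no condition.\<close>

definition reduced_exact_poised :: "(nat \<Rightarrow> point) \<Rightarrow> nat \<Rightarrow> nat \<Rightarrow> point set \<Rightarrow> bool" where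
  "reduced_exact_poised V n k A \<longleftrightarrow>
     (1 < k \<longrightarrow>
        exact V 1 (k - 1) (nodes_in A V 1 (k - 1) \<union> {V k, V (k + 1)}) \<and>
        poised V 1 (k - 1) (nodes_in A V 1 (k - 1) \<union> {V k, V (k + 1)})) \<and>
     (k + 2 < n \<longrightarrow>
        exact V (k + 3) n (nodes_in A V (k + 3) n \<union> {V (k + 3), V (k + 4)}) \<and>
        poised V (k + 3) n (nodes_in A V (k + 3) n \<union> {V (k + 3), V (k + 4)}))"

end

theory Submission
  imports Defs
begin

text \<open>
  A spline on a strip of \<open>m\<close> triangles is determined by its \<open>m + 2\<close> vertex values, which can be
  prescribed freely (\<open>spline_with_vertex_values\<close>). So evaluation at the nodes of an exact problem is
  a square linear system, and such a problem is poised iff only the zero spline vanishes at all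
  nodes, that is, iff its kernel is trivial. An injective evaluation needs at least \<open>m + 2\<close> nodes
  (\<open>trivial_kernel_card\<close>).

  The geometric core is \<open>basic_212B_zero\<close>: a spline vanishing at the five nodes of a basic
  subproblem vanishes on all three triangles. On the first triangle it is affine and zero on the line
  through the two nodes there. This line misses the middle triangle, so if the affine piece is not
  identically zero then it has one strict sign at the two vertices shared with the middle triangle.
  The same holds at the other end. The two shared sides have a vertex in common, so unless the spline
  is zero at that vertex, it has the same strict sign at all three vertices of the middle triangle
  and cannot vanish at the node of that triangle. If it is zero at the common vertex, then both outer
  pieces are zero, and with them the vertex values of all three triangles.

  Consequently the kernel of the whole problem consists of the splines that vanish on the triangles
  \<open>k, k + 1, k + 2\<close> and solve the two homogeneous reduced problems, where the added vertices express
  the vanishing on the shared sides. Conversely a solution of a homogeneous reduced problem extends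
  by zero to the whole strip (\<open>spline_zero_extension\<close>). Hence the kernel is trivial iff both reduced
  kernels are.

  That the reduced problems are exact when the original one is poised follows by counting. Let
  \<open>X\<close> and \<open>Y\<close> be the nodes of the left and right reduced problems other than the added vertices. If
  no node lies in the interior of a side shared with the basic substrip, then \<open>X\<close>, \<open>Y\<close> and the five
  basic nodes partition the \<open>n + 2\<close> nodes, so \<open>card X + card Y = n - 3\<close>. Injectivity gives
  \<open>k - 1 \<le> card X\<close> and \<open>n - k - 2 \<le> card Y\<close>, and these bounds add up to \<open>n - 3\<close>.
\<close>

section \<open>Underdetermined homogeneous linear systems\<close>

text \<open>
  Induction on the number of equations: a nonzero coefficient \<open>M e p\<close> of the new equation \<open>e\<close> is used
  to eliminate the unknown \<open>p\<close> from the other equations, at the cost of one equation and one unknown.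
\<close>

lemma underdetermined_system:
  fixes M :: "'a \<Rightarrow> 'b \<Rightarrow> real"
  assumes "finite I" "finite J" "card I < card J"
  shows "\<exists>x. (\<exists>j\<in>J. x j \<noteq> 0) \<and> (\<forall>i\<in>I. (\<Sum>j\<in>J. M i j * x j) = 0)"
  using assms
proof (induction I arbitrary: J M rule: finite_induct)
  case empty
  then have "J \<noteq> {}" by auto
  then show ?case by (intro exI[of _ "\<lambda>_. 1"]) auto
next
  case (insert e I)
  show ?case
  proof (cases "\<forall>j\<in>J. M e j = 0")
    case True
    have "card I < card J" using insert by simp
    from insert.IH[OF insert.prems(1) this, of M] True show ?thesis by auto
  next
    case False
    then obtain p where p: "p \<in> J" "M e p \<noteq> 0" by auto
    define J' where "J' = J - {p}"
    have J': "finite J'" "card I < card J'" "p \<notin> J'" "J = insert p J'"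
      using insert p by (auto simp: J'_def)
    obtain y where y: "\<exists>j\<in>J'. y j \<noteq> 0"
      and y0: "\<forall>i\<in>I. (\<Sum>j\<in>J'. (M i j - M i p * M e j / M e p) * y j) = 0"
      using insert.IH[OF J'(1,2), of "\<lambda>i j. M i j - M i p * M e j / M e p"] by auto
    \<comment> \<open>The eliminated unknown is recovered from the pivot equation.\<close>
    define x where "x = y(p := - (\<Sum>j\<in>J'. M e j * y j) / M e p)"
    have xJ': "(\<Sum>j\<in>J'. M i j * x j) = (\<Sum>j\<in>J'. M i j * y j)" for i
      using J'(3) by (intro sum.cong) (auto simp: x_def)
    have split: "(\<Sum>j\<in>J. M i j * x j) = M i p * x p + (\<Sum>j\<in>J'. M i j * y j)" for i
      using J' xJ' by simp
    have "(\<Sum>j\<in>J. M e j * x j) = 0"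
      using p by (simp add: split) (simp add: x_def)
    moreover have "(\<Sum>j\<in>J. M i j * x j) = 0" if "i \<in> I" for i
    proof -
      have "(\<Sum>j\<in>J'. (M i j - M i p * M e j / M e p) * y j)
          = (\<Sum>j\<in>J'. M i j * y j) - M i p / M e p * (\<Sum>j\<in>J'. M e j * y j)"
        by (simp add: sum_distrib_left sum_subtractf[symmetric] algebra_simps)
      then show ?thesis using y0 that by (simp add: split) (simp add: x_def)
    qed
    moreover have "\<exists>j\<in>J. x j \<noteq> 0"
      using y J'(3,4) by (auto simp: x_def)
    ultimately show ?thesis by auto
  qed
qed

section \<open>Affine functions on the plane\<close>

definition plane_affine :: "(point \<Rightarrow> real) \<Rightarrow> bool" where
  "plane_affine g \<longleftrightarrow> (\<exists>a b c. \<forall>p. g p = a + b * p $ 1 + c * p $ 2)"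

lemma plane_affine_add:
  assumes "plane_affine g" "plane_affine h"
  shows "plane_affine (\<lambda>p. g p + h p)"
proof -
  obtain a b c a' b' c' where "\<forall>p. g p = a + b * p $ 1 + c * p $ 2"
    "\<forall>p. h p = a' + b' * p $ 1 + c' * p $ 2"
    using assms unfolding plane_affine_def by blast
  then have "\<forall>p. g p + h p = (a + a') + (b + b') * p $ 1 + (c + c') * p $ 2"
    by (simp add: algebra_simps)
  then show ?thesis unfolding plane_affine_def by blast
qed

lemma plane_affine_cmult:
  assumes "plane_affine g"
  shows "plane_affine (\<lambda>p. r * g p)"
proof -
  obtain a b c where "\<forall>p. g p = a + b * p $ 1 + c * p $ 2"
    using assms unfolding plane_affine_def by blast
  then have "\<forall>p. r * g p = (r * a) + (r * b) * p $ 1 + (r * c) * p $ 2"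
    by (simp add: algebra_simps)
  then show ?thesis unfolding plane_affine_def by blast
qed

lemma plane_affine_zero: "plane_affine (\<lambda>_. 0)"
  unfolding plane_affine_def by (intro exI[of _ 0]) simp

lemma plane_affine_sum:
  assumes "finite J" "\<And>j. j \<in> J \<Longrightarrow> plane_affine (g j)"
  shows "plane_affine (\<lambda>p. \<Sum>j\<in>J. x j * g j p)"
  using assms
proof (induction J rule: finite_induct)
  case empty
  show ?case by (simp add: plane_affine_zero)
next
  case (insert i F)
  then have "plane_affine (\<lambda>p. x i * g i p + (\<Sum>j\<in>F. x j * g j p))"
    by (intro plane_affine_add plane_affine_cmult) auto
  then show ?case using insert by simp
qed

lemma plane_affine_continuous: "plane_affine g \<Longrightarrow> continuous_on S g"
  unfolding plane_affine_def
  by (elim exE, subst continuous_on_cong[OF refl]) (auto intro!: continuous_intros)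

text \<open>
  Three points suffice for triangles; segments are treated by giving the third point weight \<open>0\<close>.
\<close>

lemma plane_affine_barycentric:
  assumes "plane_affine g" "u + v + w = 1"
  shows "g (u *\<^sub>R p + v *\<^sub>R q + w *\<^sub>R r) = u * g p + v * g q + w * g r"
proof -
  obtain a b c where g: "\<And>p. g p = a + b * p $ 1 + c * p $ 2"
    using assms unfolding plane_affine_def by blast
  have u: "u = 1 - v - w" using assms by simp
  show ?thesis unfolding g u by (simp add: algebra_simps)
qed

lemma collinear_det:
  fixes p q r :: point
  assumes "(q $ 1 - p $ 1) * (r $ 2 - p $ 2) = (q $ 2 - p $ 2) * (r $ 1 - p $ 1)"
  shows "collinear {p, q, r}"
proof (cases "q = p")
  case True then show ?thesis by simp
next
  case False
  \<comment> \<open>The factor with \<open>r - p = d (q - p)\<close>, read off from a coordinate in which \<open>p\<close> and \<open>q\<close> differ.\<close>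
  define d where "d = (if q $ 1 \<noteq> p $ 1 then (r $ 1 - p $ 1) / (q $ 1 - p $ 1)
     else (r $ 2 - p $ 2) / (q $ 2 - p $ 2))"
  have ne: "q $ 1 \<noteq> p $ 1 \<or> q $ 2 \<noteq> p $ 2"
    using False by (auto simp: vec_eq_iff forall_2)
  have "r - p = d *\<^sub>R (q - p)"
    using ne assms by (auto simp: vec_eq_iff forall_2 d_def field_simps)
  then have "collinear {0, q - p, r - p}" by (auto simp: collinear_lemma)
  then have "collinear {q, p, r}" by (simp add: collinear_3)
  then show ?thesis by (simp add: insert_commute)
qed

lemma plane_affine_interpolation:
  fixes P Q R :: point
  assumes "\<not> collinear {P, Q, R}"
  shows "\<exists>g. plane_affine g \<and> g P = x \<and> g Q = y \<and> g R = z"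
proof -
  define D where "D = (Q $ 1 - P $ 1) * (R $ 2 - P $ 2) - (Q $ 2 - P $ 2) * (R $ 1 - P $ 1)"
  have D: "D \<noteq> 0" using assms collinear_det unfolding D_def by auto
  \<comment> \<open>Cramer's rule for the gradient \<open>(b, c)\<close>; the two equations are the increments from \<open>P\<close>.\<close>
  define b where "b = ((y - x) * (R $ 2 - P $ 2) - (z - x) * (Q $ 2 - P $ 2)) / D"
  define c where "c = ((z - x) * (Q $ 1 - P $ 1) - (y - x) * (R $ 1 - P $ 1)) / D"
  define g :: "point \<Rightarrow> real"
    where "g p = (x - b * P $ 1 - c * P $ 2) + b * p $ 1 + c * p $ 2" for p
  have "b * (Q $ 1 - P $ 1) + c * (Q $ 2 - P $ 2) = (y - x) * D / D"
    unfolding b_def c_def times_divide_eq_left add_divide_distrib[symmetric]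
    by (rule arg_cong[of _ _ "\<lambda>t. t / D"]) (simp add: D_def algebra_simps)
  moreover have "b * (R $ 1 - P $ 1) + c * (R $ 2 - P $ 2) = (z - x) * D / D"
    unfolding b_def c_def times_divide_eq_left add_divide_distrib[symmetric]
    by (rule arg_cong[of _ _ "\<lambda>t. t / D"]) (simp add: D_def algebra_simps)
  moreover have "(y - x) * D / D = y - x" "(z - x) * D / D = z - x" using D by simp_all
  ultimately have "g P = x" "g Q = y" "g R = z" by (simp_all add: g_def algebra_simps)
  moreover have "plane_affine g" unfolding plane_affine_def g_def by blast
  ultimately show ?thesis by blast
qed

lemma plane_affine_eq_0:
  fixes P Q R :: point
  assumes "\<not> collinear {P, Q, R}" "plane_affine g" "g P = 0" "g Q = 0" "g R = 0"
  shows "g p = 0"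
proof -
  obtain a b c where g: "\<And>p. g p = a + b * p $ 1 + c * p $ 2"
    using assms unfolding plane_affine_def by blast
  define D where "D = (Q $ 1 - P $ 1) * (R $ 2 - P $ 2) - (Q $ 2 - P $ 2) * (R $ 1 - P $ 1)"
  have D: "D \<noteq> 0" using assms collinear_det unfolding D_def by auto
  have Q: "b * (Q $ 1 - P $ 1) + c * (Q $ 2 - P $ 2) = 0"
    and R: "b * (R $ 1 - P $ 1) + c * (R $ 2 - P $ 2) = 0"
    using assms(3-5) by (simp_all add: g algebra_simps)
  have "b * D = (R $ 2 - P $ 2) * (b * (Q $ 1 - P $ 1) + c * (Q $ 2 - P $ 2))
      - (Q $ 2 - P $ 2) * (b * (R $ 1 - P $ 1) + c * (R $ 2 - P $ 2))"
    by (simp add: D_def algebra_simps)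
  also have "\<dots> = 0" unfolding Q R by simp
  finally have "b = 0" using D by simp
  have "c * D = (Q $ 1 - P $ 1) * (b * (R $ 1 - P $ 1) + c * (R $ 2 - P $ 2))
      - (R $ 1 - P $ 1) * (b * (Q $ 1 - P $ 1) + c * (Q $ 2 - P $ 2))"
    by (simp add: D_def algebra_simps)
  also have "\<dots> = 0" unfolding Q R by simp
  finally have "c = 0" using D by simp
  then show ?thesis using assms(3) \<open>b = 0\<close> by (simp add: g)
qed

text \<open>
  If \<open>g\<close> did not have one strict sign at \<open>P\<close> and \<open>Q\<close>, it would vanish somewhere on the segment
  between them, that is, off the line through its zeros \<open>S\<close> and \<open>T\<close>. An affine function with three
  noncollinear zeros is identically zero.
\<close>

lemma plane_affine_same_sign:
  fixes P Q S T :: point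
  assumes g: "plane_affine g" "g S = 0" "g T = 0" "S \<noteq> T"
    and miss: "affine hull {S, T} \<inter> closed_segment P Q = {}"
  shows "(\<forall>p. g p = 0) \<or> g P * g Q > 0"
proof (rule ccontr)
  assume contra: "\<not> ?thesis"
  then have le: "g P * g Q \<le> 0" by auto
  obtain z where z: "z \<in> closed_segment P Q" "g z = 0"
  proof (cases "g P = g Q")
    case True
    then have "g P = 0" using le by (metis not_real_square_gt_zero order_less_le not_less)
    then show ?thesis using that[of P] by simp
  next
    case False
    \<comment> \<open>The parameter at which the affine function \<open>t \<mapsto> g ((1 - t) P + t Q)\<close> vanishes.\<close>
    define t where "t = g P / (g P - g Q)"
    have t: "0 \<le> t" "t \<le> 1"
      using le False unfolding t_def
      by (auto simp: field_simps mult_le_0_iff zero_le_divide_iff divide_le_eq_1)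
    have "g ((1 - t) *\<^sub>R P + t *\<^sub>R Q + 0 *\<^sub>R Q) = (1 - t) * g P + t * g Q + 0 * g Q"
      by (rule plane_affine_barycentric[OF g(1)]) simp
    also have "\<dots> = g P - t * (g P - g Q)" by (simp add: algebra_simps)
    also have "\<dots> = 0" using False by (simp add: t_def)
    finally show ?thesis using t that[of "(1 - t) *\<^sub>R P + t *\<^sub>R Q"] by (auto simp: in_segment)
  qed
  have "z \<notin> affine hull {S, T}" using z miss by auto
  then have "\<not> collinear {S, T, z}" using g(4) by (simp add: collinear_3_affine_hull)
  from plane_affine_eq_0[OF this g(1-3) z(2)] contra show False by blast
qed

section \<open>Splines on a strip and their vertex values\<close>

lemma vertex_in_tri: "i \<le> m \<Longrightarrow> m \<le> i + 2 \<Longrightarrow> V m \<in> tri V i"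
proof -
  assume "i \<le> m" "m \<le> i + 2"
  then have "m = i \<or> m = i + 1 \<or> m = i + 2" by arith
  then show ?thesis unfolding tri_def by (auto intro!: hull_inc)
qed

lemma vertex_in_region: "i \<le> j \<Longrightarrow> i \<le> m \<Longrightarrow> m \<le> j + 2 \<Longrightarrow> V m \<in> region V i j"
proof -
  assume a: "i \<le> j" "i \<le> m" "m \<le> j + 2"
  show ?thesis
  proof (cases "m \<le> j")
    case True
    then show ?thesis using a vertex_in_tri[of m m V] unfolding region_def by auto
  next
    case False
    then show ?thesis using a vertex_in_tri[of j m V] unfolding region_def by auto
  qed
qed

lemma plane_affine_eq_on_tri:
  assumes g: "plane_affine g" "plane_affine h"
    and v: "\<And>m. i \<le> m \<Longrightarrow> m \<le> i + 2 \<Longrightarrow> g (V m) = h (V m)" and p: "p \<in> tri V i"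
  shows "g p = h p"
proof -
  obtain u v w where p: "p = u *\<^sub>R V i + v *\<^sub>R V (i + 1) + w *\<^sub>R V (i + 2)" "u + v + w = 1"
    using p unfolding tri_def convex_hull_3 by auto
  show ?thesis
    unfolding p(1) plane_affine_barycentric[OF g(1) p(2)] plane_affine_barycentric[OF g(2) p(2)]
    using v by simp
qed

lemma compact_tri: "compact (tri V i)"
  unfolding tri_def by (intro compact_convex_hull finite_imp_compact) auto

lemma closed_region: "closed (region V i j)"
  unfolding region_def by (intro closed_UN) (auto intro: compact_imp_closed compact_tri)

lemma spline_space_iff:
  "s \<in> spline_space V i j \<longleftrightarrow> s \<in> extensional (region V i j) \<and> continuous_on (region V i j) s \<and>
     (\<forall>m\<in>{i..j}. \<exists>g. plane_affine g \<and> (\<forall>p\<in>tri V m. s p = g p))"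
proof -
  have "(\<exists>a b c. \<forall>p\<in>tri V m. s p = a + b * p $ 1 + c * p $ 2) \<longleftrightarrow>
      (\<exists>g. plane_affine g \<and> (\<forall>p\<in>tri V m. s p = g p))" (is "?L \<longleftrightarrow> ?R") for m
  proof
    assume ?L
    then obtain a b c where "\<forall>p\<in>tri V m. s p = a + b * p $ 1 + c * p $ 2" by blast
    then show ?R unfolding plane_affine_def
      by (intro exI[of _ "\<lambda>p. a + b * p $ 1 + c * p $ 2"]) auto
  next
    assume ?R then show ?L unfolding plane_affine_def by fastforce
  qed
  then show ?thesis unfolding spline_space_def by simp
qed

lemma spline_piece:
  assumes "s \<in> spline_space V i j" "i \<le> m" "m \<le> j"
  obtains g where "plane_affine g" "\<And>p. p \<in> tri V m \<Longrightarrow> s p = g p"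
proof -
  have "\<exists>g. plane_affine g \<and> (\<forall>p\<in>tri V m. s p = g p)"
    using assms(1-3) unfolding spline_space_iff by auto
  then show thesis using that by blast
qed

lemma spline_eq_on_tri:
  assumes s: "s \<in> spline_space V i j" "i \<le> l" "l \<le> j"
    and t: "t \<in> spline_space V i' j'" "i' \<le> l" "l \<le> j'"
    and v: "\<And>m. l \<le> m \<Longrightarrow> m \<le> l + 2 \<Longrightarrow> s (V m) = t (V m)" and p: "p \<in> tri V l"
  shows "s p = t p"
proof -
  obtain g where g: "plane_affine g" "\<And>p. p \<in> tri V l \<Longrightarrow> s p = g p"
    using spline_piece[OF s] by blast
  obtain h where h: "plane_affine h" "\<And>p. p \<in> tri V l \<Longrightarrow> t p = h p"
    using spline_piece[OF t] by blast
  have "g p = h p"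
  proof (rule plane_affine_eq_on_tri[OF g(1) h(1) _ p])
    fix m assume m: "l \<le> m" "m \<le> l + 2"
    show "g (V m) = h (V m)"
      using v[OF m] g(2)[OF vertex_in_tri[OF m]] h(2)[OF vertex_in_tri[OF m]] by simp
  qed
  then show ?thesis using g(2)[OF p] h(2)[OF p] by simp
qed

lemma spline_combination:
  assumes "finite J" "\<And>j. j \<in> J \<Longrightarrow> H j \<in> spline_space V a b"
  shows "restrict (\<lambda>p. \<Sum>j\<in>J. x j * H j p) (region V a b) \<in> spline_space V a b"
  unfolding spline_space_iff
proof (intro conjI ballI)
  show "continuous_on (region V a b) (restrict (\<lambda>p. \<Sum>j\<in>J. x j * H j p) (region V a b))"
    using assms
    by (subst continuous_on_cong[OF refl restrict_apply'])
      (auto intro!: continuous_intros simp: spline_space_iff)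
next
  fix m assume m: "m \<in> {a..b}"
  then have "\<forall>j\<in>J. \<exists>g. plane_affine g \<and> (\<forall>p\<in>tri V m. H j p = g p)"
    using assms(2) unfolding spline_space_iff by auto
  then obtain g where g: "\<forall>j\<in>J. plane_affine (g j) \<and> (\<forall>p\<in>tri V m. H j p = g j p)"
    by metis
  have "tri V m \<subseteq> region V a b" using m unfolding region_def by auto
  then show "\<exists>h. plane_affine h \<and>
      (\<forall>p\<in>tri V m. restrict (\<lambda>p. \<Sum>j\<in>J. x j * H j p) (region V a b) p = h p)"
    using g assms(1)
    by (intro exI[of _ "\<lambda>p. \<Sum>j\<in>J. x j * g j p"])
      (auto intro!: plane_affine_sum sum.cong)
qed simp

lemma spline_diff:
  assumes "s \<in> spline_space V a b" "t \<in> spline_space V a b"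
  shows "restrict (\<lambda>p. s p - t p) (region V a b) \<in> spline_space V a b"
  using spline_combination[of UNIV "\<lambda>j. if j then s else t" V a b "\<lambda>j. if j then 1 else -1"] assms
  by (simp add: UNIV_bool cong: restrict_cong)

lemma spline_zero: "restrict (\<lambda>_. 0) (region V a b) \<in> spline_space V a b"
  using spline_combination[of "{}" _ V a b] by simp

lemma region_mono: "a \<le> i \<Longrightarrow> j \<le> b \<Longrightarrow> region V i j \<subseteq> region V a b"
  unfolding region_def by force

lemma spline_restrict:
  assumes "s \<in> spline_space V a b" "a \<le> i" "j \<le> b"
  shows "restrict s (region V i j) \<in> spline_space V i j"
  unfolding spline_space_iff
proof (intro conjI ballI)
  show "continuous_on (region V i j) (restrict s (region V i j))"
    using assms region_mono[of a i j b V]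
    by (subst continuous_on_cong[OF refl restrict_apply'])
      (auto simp: spline_space_iff intro: continuous_on_subset)
next
  fix m assume m: "m \<in> {i..j}"
  then obtain g where "plane_affine g" "\<And>p. p \<in> tri V m \<Longrightarrow> s p = g p"
    using spline_piece[OF assms(1), of m] assms(2,3) by auto
  then show "\<exists>g. plane_affine g \<and> (\<forall>p\<in>tri V m. restrict s (region V i j) p = g p)"
    using m unfolding region_def by (intro exI[of _ g]) auto
qed simp

text \<open>
  Cutting a strip behind triangle \<open>j\<close> leaves only one side in common: triangles \<open>j\<close> and \<open>j + 1\<close> share
  this side, two triangles whose indices differ by \<open>2\<close> across the cut share one of its end points,
  and all others are disjoint. This locates the nodes that are counted in two substrips and shows
  that pieces glued along the cut need to agree on this side only.
\<close>

lemma region_Int_region: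
  assumes strip: "is_strip V n" and "1 \<le> i" "l \<le> n"
  shows "region V i j \<inter> region V (j + 1) l \<subseteq> closed_segment (V (j + 1)) (V (j + 2))"
proof
  fix p assume p: "p \<in> region V i j \<inter> region V (j + 1) l"
  obtain a where "i \<le> a" "a \<le> j" "p \<in> tri V a" using p unfolding region_def by auto
  moreover obtain b where "j + 1 \<le> b" "b \<le> l" "p \<in> tri V b" using p unfolding region_def by auto
  ultimately have ab: "i \<le> a" "a \<le> j" "j < b" "b \<le> l" "p \<in> tri V a \<inter> tri V b" by auto
  have a: "1 \<le> a" "b \<le> n" using ab assms by auto
  consider "a + 3 \<le> b" | "a = j" "b = j + 1" | "a + 2 = j + 1" "b = j + 1" | "a = j" "b = j + 2"
    using ab by linarith
  then show "p \<in> closed_segment (V (j + 1)) (V (j + 2))"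
  proof cases
    case 1
    then have "tri V a \<inter> tri V b = {}" using strip a unfolding is_strip_def by blast
    then show ?thesis using ab by auto
  next
    case 2
    then have "tri V a \<inter> tri V b = closed_segment (V (j + 1)) (V (j + 2))"
      using strip a unfolding is_strip_def by blast
    then show ?thesis using ab by auto
  next
    case 3
    have range: "1 \<le> a \<and> a + 2 \<le> n" using a 3 by linarith
    have "tri V a \<inter> tri V (a + 2) = {V (a + 2)}"
      using strip range unfolding is_strip_def by blast
    moreover have "b = a + 2" using 3 by linarith
    ultimately have "p = V (a + 2)" using ab(5) by blast
    then show ?thesis using 3 by simp
  next
    case 4
    have range: "1 \<le> a \<and> a + 2 \<le> n" using a 4 by linarith
    have "tri V a \<inter> tri V (a + 2) = {V (a + 2)}"
      using strip range unfolding is_strip_def by blast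
    moreover have "b = a + 2" using 4 by linarith
    ultimately have "p = V (a + 2)" using ab(5) by blast
    then show ?thesis using 4 by simp
  qed
qed

lemma tri_interpolation:
  assumes "is_strip V n" "1 \<le> i" "i \<le> n"
  shows "\<exists>g. plane_affine g \<and> (\<forall>m. i \<le> m \<and> m \<le> i + 2 \<longrightarrow> g (V m) = w m)"
proof -
  have "\<not> collinear {V i, V (i + 1), V (i + 2)}" using assms unfolding is_strip_def by blast
  from plane_affine_interpolation[OF this, of "w i" "w (i + 1)" "w (i + 2)"]
  obtain g where g: "plane_affine g" "g (V i) = w i" "g (V (i + 1)) = w (i + 1)"
      "g (V (i + 2)) = w (i + 2)" by blast
  have "g (V m) = w m" if "i \<le> m" "m \<le> i + 2" for m
  proof -
    have "m = i \<or> m = i + 1 \<or> m = i + 2" using that by arith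
    then show ?thesis using g by auto
  qed
  then show ?thesis using g(1) by blast
qed

text \<open>
  The spline is built triangle by triangle. The new affine piece has two of its vertex values
  prescribed by the preceding pieces, so it agrees with them on the common side, which by
  \<open>region_Int_region\<close> is the whole overlap; hence the union of the two is continuous.
\<close>

lemma spline_with_vertex_values:
  assumes strip: "is_strip V n" and i: "1 \<le> i" and "i \<le> j" "j \<le> n"
  shows "\<exists>s\<in>spline_space V i j. \<forall>m. i \<le> m \<and> m \<le> j + 2 \<longrightarrow> s (V m) = w m"
  using assms(3,4)
proof (induction j rule: dec_induct)
  case base
  obtain g where g: "plane_affine g" "\<forall>m. i \<le> m \<and> m \<le> i + 2 \<longrightarrow> g (V m) = w m"
    using tri_interpolation[OF strip i, of w] base by auto
  have reg: "region V i i = tri V i" unfolding region_def by simp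
  have "restrict g (tri V i) \<in> spline_space V i i"
    unfolding spline_space_iff reg
  proof (intro conjI ballI)
    show "continuous_on (tri V i) (restrict g (tri V i))"
      by (subst continuous_on_cong[OF refl restrict_apply'])
        (auto intro: plane_affine_continuous[OF g(1)])
    show "\<exists>h. plane_affine h \<and> (\<forall>p\<in>tri V m. restrict g (tri V i) p = h p)" if "m \<in> {i..i}" for m
      using that g(1) by (intro exI[of _ g]) auto
  qed simp
  then show ?case using g(2) vertex_in_tri[of i _ V]
    by (intro bexI[of _ "restrict g (tri V i)"]) auto
next
  case (step j)
  then obtain s where s: "s \<in> spline_space V i j" "\<And>m. i \<le> m \<Longrightarrow> m \<le> j + 2 \<Longrightarrow> s (V m) = w m"
    by auto
  obtain g where g: "plane_affine g" "\<And>m. j + 1 \<le> m \<Longrightarrow> m \<le> j + 3 \<Longrightarrow> g (V m) = w m"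
    using tri_interpolation[OF strip, of "j + 1" w] step by auto
  obtain h where h: "plane_affine h" "\<And>p. p \<in> tri V j \<Longrightarrow> s p = h p"
    using spline_piece[OF s(1), of j] step by auto
  have reg: "region V i (Suc j) = region V i j \<union> tri V (j + 1)"
    unfolding region_def using step by (auto simp: atLeastAtMostSuc_conv)
  have agree: "s p = g p" if p: "p \<in> region V i j" "p \<in> tri V (j + 1)" for p
  proof -
    have "p \<in> closed_segment (V (j + 1)) (V (j + 2))"
      using region_Int_region[OF strip i, of "j + 1" j] p step by (auto simp: region_def)
    then obtain u where u: "p = (1 - u) *\<^sub>R V (j + 1) + u *\<^sub>R V (j + 2) + 0 *\<^sub>R V (j + 2)"
      by (auto simp: in_segment)
    have uw: "1 - u + u + 0 = 1" by simp
    have "closed_segment (V (j + 1)) (V (j + 2)) \<subseteq> tri V j"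
      using vertex_in_tri[of j "j + 1" V] vertex_in_tri[of j "j + 2" V]
      by (intro closed_segment_subset) (auto simp: tri_def)
    then have "s p = h p" using h(2) \<open>p \<in> closed_segment _ _\<close> by auto
    moreover have "h (V m) = g (V m)" if "m = j + 1 \<or> m = j + 2" for m
      using that h(2)[of "V m"] vertex_in_tri[of j m V] s(2)[of m] g(2)[of m] step by auto
    then have "h p = g p"
      unfolding u plane_affine_barycentric[OF h(1) uw] plane_affine_barycentric[OF g(1) uw] by simp
    ultimately show ?thesis by simp
  qed
  define t where "t p = (if p \<in> region V i j then s p else if p \<in> tri V (j + 1) then g p
    else undefined)" for p
  have ts: "t p = s p" if "p \<in> region V i j" for p using that by (simp add: t_def)
  have tg: "t p = g p" if "p \<in> tri V (j + 1)" for p using that agree by (simp add: t_def)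
  have "t \<in> spline_space V i (Suc j)"
    unfolding spline_space_iff
  proof (intro conjI ballI)
    show "t \<in> extensional (region V i (Suc j))" unfolding reg extensional_def t_def by auto
    have "continuous_on (region V i j) t"
      using s(1) ts unfolding spline_space_iff by (simp cong: continuous_on_cong)
    moreover have "continuous_on (tri V (j + 1)) t"
      using plane_affine_continuous[OF g(1)] tg by (simp cong: continuous_on_cong)
    ultimately show "continuous_on (region V i (Suc j)) t"
      unfolding reg
      by (intro continuous_on_closed_Un closed_region compact_imp_closed[OF compact_tri])
    show "\<exists>h. plane_affine h \<and> (\<forall>p\<in>tri V m. t p = h p)" if m: "m \<in> {i..Suc j}" for m
    proof (cases "m = Suc j")
      case True
      then show ?thesis using g(1) tg by auto
    next
      case False
      then have mj: "i \<le> m" "m \<le> j" using m by auto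
      obtain f where f: "plane_affine f" "\<And>p. p \<in> tri V m \<Longrightarrow> s p = f p"
        using spline_piece[OF s(1) mj] by blast
      have "tri V m \<subseteq> region V i j" using mj unfolding region_def by auto
      then have "\<forall>p\<in>tri V m. t p = f p" using ts f(2) by (simp add: subset_iff)
      then show ?thesis using f(1) by blast
    qed
  qed
  moreover have "t (V m) = w m" if "i \<le> m" "m \<le> Suc j + 2" for m
  proof (cases "m \<le> j + 2")
    case True
    then show ?thesis using that ts s(2) vertex_in_region[of i j m V] step by simp
  next
    case False
    then show ?thesis using that tg[of "V m"] g(2)[of m] vertex_in_tri[of "j + 1" m V] by simp
  qed
  ultimately show ?case by blast
qed

text \<open>
  Setting all vertex values outside the substrip to \<open>0\<close> extends a spline to the whole strip. The
  extension is zero on a triangle outside the substrip as soon as \<open>s\<close> vanishes at the vertices which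
  that triangle shares with the substrip.
\<close>

lemma spline_zero_extension:
  assumes strip: "is_strip V n" and ij: "1 \<le> i" "i \<le> j" "j \<le> n"
    and s: "s \<in> spline_space V i j"
  obtains t where "t \<in> spline_space V 1 n" "\<And>p. p \<in> region V i j \<Longrightarrow> t p = s p"
    "\<And>m. 1 \<le> m \<Longrightarrow> m \<le> n + 2 \<Longrightarrow> \<not> (i \<le> m \<and> m \<le> j + 2) \<Longrightarrow> t (V m) = 0"
proof -
  obtain t where t: "t \<in> spline_space V 1 n"
    "\<And>m. 1 \<le> m \<Longrightarrow> m \<le> n + 2 \<Longrightarrow> t (V m) = (if i \<le> m \<and> m \<le> j + 2 then s (V m) else 0)"
    using spline_with_vertex_values[OF strip, of 1 n "\<lambda>m. if i \<le> m \<and> m \<le> j + 2 then s (V m) else 0"]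
      ij by auto
  have "t p = s p" if p: "p \<in> region V i j" for p
  proof -
    obtain l where l: "i \<le> l" "l \<le> j" "p \<in> tri V l" using p unfolding region_def by auto
    show ?thesis
    proof (rule spline_eq_on_tri[OF t(1) _ _ s l(1,2) _ l(3)])
      show "1 \<le> l" "l \<le> n" using l ij by auto
      show "t (V m) = s (V m)" if "l \<le> m" "m \<le> l + 2" for m
        using that l ij t(2)[of m] by simp
    qed
  qed
  then show ?thesis using t(2) by (intro that[OF t(1)]) auto
qed

section \<open>Poisedness as triviality of the kernel\<close>

text \<open>
  Injectivity of the evaluation of splines at the points of \<open>A\<close>.
\<close>

definition trivial_kernel :: "(nat \<Rightarrow> point) \<Rightarrow> nat \<Rightarrow> nat \<Rightarrow> point set \<Rightarrow> bool" where
  "trivial_kernel V i j A \<longleftrightarrow>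
     (\<forall>s\<in>spline_space V i j. (\<forall>a\<in>A. s a = 0) \<longrightarrow> (\<forall>p\<in>region V i j. s p = 0))"

lemma poised_imp_trivial_kernel:
  assumes "poised V i j A" "A \<subseteq> region V i j"
  shows "trivial_kernel V i j A"
  unfolding trivial_kernel_def
proof (intro ballI impI)
  fix s p assume s: "s \<in> spline_space V i j" "\<forall>a\<in>A. s a = 0" and p: "p \<in> region V i j"
  have "\<exists>!s. s \<in> spline_space V i j \<and> (\<forall>a\<in>A. s a = 0)"
    using assms(1) unfolding poised_def by (elim allE[of _ "\<lambda>_. 0"]) simp
  moreover have "\<forall>a\<in>A. restrict (\<lambda>_. 0 :: real) (region V i j) a = 0" using assms(2) by auto
  ultimately have "s = restrict (\<lambda>_. 0) (region V i j)" using s spline_zero[of V i j] by blast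
  then show "s p = 0" using p by simp
qed

text \<open>
  The splines that are \<open>1\<close> at one vertex and \<open>0\<close> at the others form a basis; the coordinates of a
  combination are its vertex values, so a combination with a nonzero coefficient is a nonzero spline.
\<close>

lemma hat_splines:
  assumes strip: "is_strip V n" and ij: "1 \<le> i" "i \<le> j" "j \<le> n"
  obtains H where "\<And>m. H m \<in> spline_space V i j"
    "\<And>x l. i \<le> l \<Longrightarrow> l \<le> j + 2 \<Longrightarrow> (\<Sum>m\<in>{i..j + 2}. x m * H m (V l)) = (x l :: real)"
proof -
  have "\<exists>s. s \<in> spline_space V i j \<and>
      (\<forall>l. i \<le> l \<and> l \<le> j + 2 \<longrightarrow> s (V l) = (if l = m then 1 else 0))" for m
    using spline_with_vertex_values[OF strip ij, of "\<lambda>l. if l = m then 1 else 0"] by blast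
  then obtain H where H: "\<forall>m. H m \<in> spline_space V i j \<and>
      (\<forall>l. i \<le> l \<and> l \<le> j + 2 \<longrightarrow> H m (V l) = (if l = m then 1 else 0))" by metis
  have "(\<Sum>m\<in>{i..j + 2}. x m * H m (V l)) = x l" if "i \<le> l" "l \<le> j + 2" for x l
  proof -
    have "(\<Sum>m\<in>{i..j + 2}. x m * H m (V l)) = (\<Sum>m\<in>{i..j + 2}. if l = m then x m else 0)"
      using H that by (intro sum.cong) auto
    then show ?thesis using that by simp
  qed
  then show ?thesis using H by (intro that[of H]) blast+
qed

text \<open>
  With fewer nodes than vertices, the homogeneous system for the coefficients in the basis of hat
  splines is underdetermined and a nonzero spline vanishes at all nodes.
\<close>

lemma trivial_kernel_card:
  assumes strip: "is_strip V n" and ij: "1 \<le> i" "i \<le> j" "j \<le> n"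
    and A: "finite A" "A \<subseteq> region V i j" and ker: "trivial_kernel V i j A"
  shows "card {i..j} + 2 \<le> card A"
proof (rule ccontr)
  assume "\<not> ?thesis"
  then have less: "card A < card {i..j + 2}" using ij by simp
  obtain H where H: "\<And>m. H m \<in> spline_space V i j"
    "\<And>x l. i \<le> l \<Longrightarrow> l \<le> j + 2 \<Longrightarrow> (\<Sum>m\<in>{i..j + 2}. x m * H m (V l)) = (x l :: real)"
    by (rule hat_splines[OF strip ij]) blast
  obtain x where x: "\<exists>m\<in>{i..j + 2}. x m \<noteq> 0" "\<forall>a\<in>A. (\<Sum>m\<in>{i..j + 2}. H m a * x m) = 0"
    using underdetermined_system[OF A(1) _ less, of "\<lambda>a m. H m a"] by auto
  define s where "s = restrict (\<lambda>p. \<Sum>m\<in>{i..j + 2}. x m * H m p) (region V i j)"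
  have "s \<in> spline_space V i j" unfolding s_def by (intro spline_combination H(1)) simp
  moreover have "\<forall>a\<in>A. s a = 0" using x(2) A(2) by (auto simp: s_def mult.commute)
  ultimately have z: "\<forall>p\<in>region V i j. s p = 0" using ker unfolding trivial_kernel_def by blast
  have "x l = 0" if l: "i \<le> l" "l \<le> j + 2" for l
    using z vertex_in_region[OF ij(2) l, of V] H(2)[OF l, of x] by (auto simp: s_def)
  then show False using x(1) by auto
qed

text \<open>
  Existence is obtained from homogeneous systems alone: adjoining an unknown \<open>x (j + 3)\<close>, one index
  beyond the vertices, with the negated data as its column gives one unknown more than equations. In a
  nontrivial solution this unknown is nonzero, since otherwise the rest would be a nonzero element of
  the kernel; dividing by it yields the interpolant.
\<close>

lemma trivial_kernel_imp_poised:
  assumes strip: "is_strip V n" and ij: "1 \<le> i" "i \<le> j" "j \<le> n"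
    and ex: "exact V i j A" and ker: "trivial_kernel V i j A"
  shows "poised V i j A"
  unfolding poised_def
proof (intro allI ex_ex1I)
  fix c :: "point \<Rightarrow> real"
  have A: "finite A" "A \<subseteq> region V i j" "card A = card {i..j} + 2"
    using ex unfolding exact_def by auto
  have less: "card A < card {i..j + 3}" using ij A(3) by simp
  obtain H where H: "\<And>m. H m \<in> spline_space V i j"
    "\<And>x l. i \<le> l \<Longrightarrow> l \<le> j + 2 \<Longrightarrow> (\<Sum>m\<in>{i..j + 2}. x m * H m (V l)) = (x l :: real)"
    by (rule hat_splines[OF strip ij]) blast
  obtain x where x: "\<exists>m\<in>{i..j + 3}. x m \<noteq> 0"
    "\<forall>a\<in>A. (\<Sum>m\<in>{i..j + 3}. (if m = j + 3 then - c a else H m a) * x m) = 0"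
    using underdetermined_system[OF A(1) _ less, of "\<lambda>a m. if m = j + 3 then - c a else H m a"] by auto
  have set: "{i..j + 3} = insert (j + 3) {i..j + 2}" using ij by auto
  have eq: "(\<Sum>m\<in>{i..j + 2}. x m * H m a) = c a * x (j + 3)" if "a \<in> A" for a
  proof -
    have "(\<Sum>m\<in>{i..j + 2}. (if m = j + 3 then - c a else H m a) * x m)
        = (\<Sum>m\<in>{i..j + 2}. x m * H m a)" by (intro sum.cong) auto
    then show ?thesis using x(2) that unfolding set by simp
  qed
  have x3: "x (j + 3) \<noteq> 0"
  proof
    assume 0: "x (j + 3) = 0"
    define s where "s = restrict (\<lambda>p. \<Sum>m\<in>{i..j + 2}. x m * H m p) (region V i j)"
    have "s \<in> spline_space V i j" unfolding s_def by (intro spline_combination H(1)) simp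
    moreover have "\<forall>a\<in>A. s a = 0" using eq 0 A(2) by (auto simp: s_def)
    ultimately have z: "\<forall>p\<in>region V i j. s p = 0" using ker unfolding trivial_kernel_def by blast
    have "x l = 0" if l: "i \<le> l" "l \<le> j + 2" for l
      using z vertex_in_region[OF ij(2) l, of V] H(2)[OF l, of x] by (auto simp: s_def)
    then show False using x(1) 0 unfolding set by auto
  qed
  define s where
    "s = restrict (\<lambda>p. \<Sum>m\<in>{i..j + 2}. (x m / x (j + 3)) * H m p) (region V i j)"
  have "s \<in> spline_space V i j" unfolding s_def by (intro spline_combination H(1)) simp
  moreover have "s a = c a" if "a \<in> A" for a
    using eq[OF that] that A(2) x3
    by (auto simp: s_def sum_divide_distrib[symmetric] times_divide_eq_left)
  ultimately show "\<exists>s. s \<in> spline_space V i j \<and> (\<forall>a\<in>A. s a = c a)" by blast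
next
  fix c s t
  assume s: "s \<in> spline_space V i j \<and> (\<forall>a\<in>A. s a = c a)"
    and t: "t \<in> spline_space V i j \<and> (\<forall>a\<in>A. t a = c a)"
  define d where "d = restrict (\<lambda>p. s p - t p) (region V i j)"
  have "A \<subseteq> region V i j" using ex unfolding exact_def by simp
  then have "\<forall>a\<in>A. d a = 0" using s t by (auto simp: d_def)
  moreover have "d \<in> spline_space V i j" unfolding d_def using s t by (intro spline_diff) auto
  ultimately have "\<forall>p\<in>region V i j. d p = 0" using ker unfolding trivial_kernel_def by blast
  then have "\<And>p. p \<in> region V i j \<Longrightarrow> s p = t p" by (simp add: d_def)
  moreover have "s \<in> extensional (region V i j)" "t \<in> extensional (region V i j)"
    using s t unfolding spline_space_iff by auto
  ultimately show "s = t" using extensionalityI by blast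
qed

section \<open>The basic subproblem\<close>

text \<open>
  The argument is described at the top: \<open>g1\<close>, \<open>g2\<close>, \<open>g3\<close> are the affine pieces on the three triangles,
  and \<open>V (k + 2)\<close> is the vertex common to all of them.
\<close>

lemma basic_212B_zero:
  assumes s: "s \<in> spline_space V i j" "i \<le> k" "k + 2 \<le> j"
    and basic: "basic_212B V k B" and B0: "\<forall>a\<in>B. s a = 0"
    and m: "k \<le> m" "m \<le> k + 4"
  shows "s (V m) = 0"
proof -
  obtain g1 where g1: "plane_affine g1" "\<And>p. p \<in> tri V k \<Longrightarrow> s p = g1 p"
    using spline_piece[OF s(1), of k] s by auto
  obtain g2 where g2: "plane_affine g2" "\<And>p. p \<in> tri V (k + 1) \<Longrightarrow> s p = g2 p"
    using spline_piece[OF s(1), of "k + 1"] s by auto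
  obtain g3 where g3: "plane_affine g3" "\<And>p. p \<in> tri V (k + 2) \<Longrightarrow> s p = g3 p"
    using spline_piece[OF s(1), of "k + 2"] s by auto
  obtain S1 T1 where ST1: "B \<inter> tri V k = {S1, T1}" "S1 \<noteq> T1"
    using basic unfolding basic_212B_def card_2_iff by blast
  obtain S3 T3 where ST3: "B \<inter> tri V (k + 2) = {S3, T3}" "S3 \<noteq> T3"
    using basic unfolding basic_212B_def card_2_iff by blast
  have "card (B \<inter> tri V (k + 1)) = 1" using basic unfolding basic_212B_def by simp
  then obtain b where "B \<inter> tri V (k + 1) = {b}" by (rule card_1_singletonE)
  then have b: "b \<in> B" "b \<in> tri V (k + 1)" by auto
  have seg: "closed_segment (V l) (V m) \<subseteq> tri V (k + 1)"
    if "k + 1 \<le> l" "l \<le> k + 3" "k + 1 \<le> m" "m \<le> k + 3" for l m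
    using vertex_in_tri[of "k + 1" l V] vertex_in_tri[of "k + 1" m V] that
    by (intro closed_segment_subset) (auto simp: tri_def)
  have 1: "(\<forall>p. g1 p = 0) \<or> g1 (V (k + 1)) * g1 (V (k + 2)) > 0"
  proof (rule plane_affine_same_sign[OF g1(1) _ _ ST1(2)])
    show "g1 S1 = 0" "g1 T1 = 0" using g1(2) ST1(1) B0 by (metis IntE insertI1 insertI2)+
    show "affine hull {S1, T1} \<inter> closed_segment (V (k + 1)) (V (k + 2)) = {}"
      using basic seg[of "k + 1" "k + 2"] unfolding basic_212B_def ST1(1) by auto
  qed
  have 3: "(\<forall>p. g3 p = 0) \<or> g3 (V (k + 2)) * g3 (V (k + 3)) > 0"
  proof (rule plane_affine_same_sign[OF g3(1) _ _ ST3(2)])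
    show "g3 S3 = 0" "g3 T3 = 0" using g3(2) ST3(1) B0 by (metis IntE insertI1 insertI2)+
    show "affine hull {S3, T3} \<inter> closed_segment (V (k + 2)) (V (k + 3)) = {}"
      using basic seg[of "k + 2" "k + 3"] unfolding basic_212B_def ST3(1) by auto
  qed
  have v: "g1 (V l) = s (V l)" if "k \<le> l" "l \<le> k + 2" for l
    using g1(2) vertex_in_tri[of k l V] that by simp
  have v2: "g2 (V l) = s (V l)" if "k + 1 \<le> l" "l \<le> k + 3" for l
    using g2(2) vertex_in_tri[of "k + 1" l V] that by simp
  have v3: "g3 (V l) = s (V l)" if "k + 2 \<le> l" "l \<le> k + 4" for l
    using g3(2) vertex_in_tri[of "k + 2" l V] that by simp
  \<comment> \<open>Otherwise \<open>s\<close> has one strict sign at the vertices of the middle triangle, and so at its node \<open>b\<close>.\<close>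
  have mid: "s (V (k + 2)) = 0"
  proof (rule ccontr)
    assume ne: "s (V (k + 2)) \<noteq> 0"
    then have pos: "s (V (k + 1)) * s (V (k + 2)) > 0" "s (V (k + 2)) * s (V (k + 3)) > 0"
      using 1 3 v[of "k + 1"] v[of "k + 2"] v3[of "k + 2"] v3[of "k + 3"] by auto
    \<comment> \<open>Multiplying by \<open>y\<close> makes all three vertex values positive, whatever their common sign.\<close>
    define y where "y = s (V (k + 2))"
    obtain t u w where c: "b = t *\<^sub>R V (k + 1) + u *\<^sub>R V (k + 2) + w *\<^sub>R V (k + 3)"
        "0 \<le> t" "0 \<le> u" "0 \<le> w" "t + u + w = 1"
      using b(2) unfolding tri_def convex_hull_3 by (auto simp: numeral_3_eq_3)
    have "0 = y * g2 b" using b B0 g2(2) by auto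
    also have "\<dots> = t * (y * s (V (k + 1))) + u * (y * y) + w * (y * s (V (k + 3)))"
      unfolding c(1) plane_affine_barycentric[OF g2(1) c(5)]
      using v2[of "k + 1"] v2[of "k + 2"] v2[of "k + 3"] by (simp add: y_def algebra_simps)
    also have "\<dots> > 0"
    proof -
      have *: "y * s (V (k + 1)) > 0" "y * y > 0" "y * s (V (k + 3)) > 0"
        using pos ne by (auto simp: y_def mult.commute zero_less_mult_iff)
      then have "0 \<le> t * (y * s (V (k + 1)))" "0 \<le> u * (y * y)" "0 \<le> w * (y * s (V (k + 3)))"
        using c by auto
      moreover have "t > 0 \<or> u > 0 \<or> w > 0" using c by linarith
      then have "0 < t * (y * s (V (k + 1))) \<or> 0 < u * (y * y) \<or> 0 < w * (y * s (V (k + 3)))"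
        using * by (meson mult_pos_pos)
      ultimately show ?thesis by linarith
    qed
    finally show False by simp
  qed
  have "\<forall>p. g1 p = 0" using 1 mid v[of "k + 2"] by simp
  moreover have "\<forall>p. g3 p = 0" using 3 mid v3[of "k + 2"] by simp
  ultimately show ?thesis using v[of m] v3[of m] m by (cases "m \<le> k + 2") auto
qed

text \<open>
  The nodes of the outer triangles lie on lines that miss the middle triangle, so they are not shared
  with it; the outer triangles meet only in \<open>V (k + 2)\<close>, a vertex of the middle one. Hence no node is
  counted twice.
\<close>

lemma basic_212B_card:
  assumes strip: "is_strip V n" and k: "1 \<le> k" "k + 2 \<le> n" and basic: "basic_212B V k B"
  shows "card B = 5"
proof -
  have c: "card (B \<inter> tri V k) = 2" "card (B \<inter> tri V (k + 1)) = 1" "card (B \<inter> tri V (k + 2)) = 2"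
    using basic unfolding basic_212B_def by auto
  then have f: "finite (B \<inter> tri V k)" "finite (B \<inter> tri V (k + 1))" "finite (B \<inter> tri V (k + 2))"
    by (auto intro: card_ge_0_finite)
  have d1: "(B \<inter> tri V k) \<inter> tri V (k + 1) = {}" "(B \<inter> tri V (k + 2)) \<inter> tri V (k + 1) = {}"
    using basic hull_subset[of "B \<inter> tri V k" affine] hull_subset[of "B \<inter> tri V (k + 2)" affine]
    unfolding basic_212B_def by auto
  have common: "tri V k \<inter> tri V (k + 2) = {V (k + 2)}"
    using strip k unfolding is_strip_def by blast
  have "V (k + 2) \<in> tri V k" "V (k + 2) \<in> tri V (k + 1)" by (intro vertex_in_tri; simp)+
  then have "V (k + 2) \<notin> B" using d1(1) by blast
  moreover have "(B \<inter> tri V k) \<inter> (B \<inter> tri V (k + 2)) = B \<inter> {V (k + 2)}"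
    unfolding common[symmetric] by blast
  ultimately have d2: "(B \<inter> tri V k) \<inter> (B \<inter> tri V (k + 2)) = {}" by simp
  have "{k..k + 2} = {k, k + 1, k + 2}" by auto
  then have "B = (B \<inter> tri V k) \<union> (B \<inter> tri V (k + 1)) \<union> (B \<inter> tri V (k + 2))"
    using basic unfolding basic_212B_def region_def by auto
  moreover have "card ((B \<inter> tri V k) \<union> (B \<inter> tri V (k + 1)) \<union> (B \<inter> tri V (k + 2))) = 2 + 1 + 2"
    using f d1 d2 c by (subst card_Un_disjoint; (subst card_Un_disjoint)?) auto
  ultimately show ?thesis by simp
qed

section \<open>Kernels of the problem and of its reduced problems\<close>

lemma region_split:
  assumes "i \<le> m + 1" "m \<le> j"
  shows "region V i j = region V i m \<union> region V (m + 1) j"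
proof -
  have "{i..j} = {i..m} \<union> {m + 1..j}" using assms by auto
  then show ?thesis unfolding region_def by auto
qed

lemma spline_zero_on_substrip:
  assumes ker: "trivial_kernel V i j (nodes_in A V i j \<union> {V l, V m})"
    and s: "s \<in> spline_space V 1 n" "\<forall>a\<in>A. s a = 0" "s (V l) = 0" "s (V m) = 0"
    and ij: "1 \<le> i" "j \<le> n" and lm: "V l \<in> region V i j" "V m \<in> region V i j"
    and p: "p \<in> region V i j"
  shows "s p = 0"
proof -
  have "restrict s (region V i j) \<in> spline_space V i j" using spline_restrict[OF s(1)] ij by blast
  moreover have "\<forall>a\<in>nodes_in A V i j \<union> {V l, V m}. restrict s (region V i j) a = 0"
    using s lm by (auto simp: nodes_in_def)
  ultimately have "\<forall>p\<in>region V i j. restrict s (region V i j) p = 0"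
    using ker unfolding trivial_kernel_def by blast
  then show ?thesis using p by simp
qed

text \<open>
  A spline in the kernel on the substrip extends by zero to one in the kernel on the strip. The last
  assumption says that \<open>C\<close> contains every vertex of the substrip that also belongs to a triangle
  outside; it makes the extension vanish on all triangles outside the substrip, and thus at the nodes
  lying there.
\<close>

lemma trivial_kernel_substrip:
  assumes strip: "is_strip V n" and ij: "1 \<le> i" "i \<le> j" "j \<le> n"
    and ker: "trivial_kernel V 1 n A" and A: "A \<subseteq> region V 1 n"
    and C: "nodes_in A V i j \<subseteq> C"
    and outer: "\<And>m v. 1 \<le> m \<Longrightarrow> m \<le> n \<Longrightarrow> \<not> (i \<le> m \<and> m \<le> j) \<Longrightarrow> m \<le> v \<Longrightarrow> v \<le> m + 2 \<Longrightarrow>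
       i \<le> v \<Longrightarrow> v \<le> j + 2 \<Longrightarrow> V v \<in> C"
  shows "trivial_kernel V i j C"
  unfolding trivial_kernel_def
proof (intro ballI impI)
  fix s p assume s: "s \<in> spline_space V i j" "\<forall>a\<in>C. s a = 0" and p: "p \<in> region V i j"
  obtain t where t: "t \<in> spline_space V 1 n" "\<And>p. p \<in> region V i j \<Longrightarrow> t p = s p"
    "\<And>m. 1 \<le> m \<Longrightarrow> m \<le> n + 2 \<Longrightarrow> \<not> (i \<le> m \<and> m \<le> j + 2) \<Longrightarrow> t (V m) = 0"
    by (rule spline_zero_extension[OF strip ij s(1)]) blast
  have "t a = 0" if a: "a \<in> A" for a
  proof (cases "a \<in> region V i j")
    case True
    then show ?thesis using a s(2) C t(2) by (auto simp: nodes_in_def)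
  next
    case False
    have am: "a \<in> region V 1 n" using a A by auto
    then obtain m where m: "1 \<le> m" "m \<le> n" "a \<in> tri V m" unfolding region_def by auto
    have nm: "\<not> (i \<le> m \<and> m \<le> j)" using False m unfolding region_def by auto
    \<comment> \<open>On a triangle outside, all vertex values of \<open>t\<close> are zero, so \<open>t\<close> agrees with the zero spline.\<close>
    have "t a = restrict (\<lambda>_. 0) (region V 1 n) a"
    proof (rule spline_eq_on_tri[OF t(1) m(1,2) spline_zero m(1,2) _ m(3)])
      fix v assume v: "m \<le> v" "v \<le> m + 2"
      have "t (V v) = 0"
      proof (cases "i \<le> v \<and> v \<le> j + 2")
        case True
        then have "V v \<in> C" using outer[OF m(1,2) nm v] by simp
        moreover have "V v \<in> region V i j" using True vertex_in_region ij by blast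
        ultimately show ?thesis using s t(2) by simp
      next
        case False
        then show ?thesis using t(3)[of v] v m by simp
      qed
      moreover have "V v \<in> region V 1 n" using vertex_in_region[of 1 n v V] v m by simp
      ultimately show "t (V v) = restrict (\<lambda>_. 0) (region V 1 n) (V v)" by simp
    qed
    then show ?thesis using am by simp
  qed
  then have "\<forall>p\<in>region V 1 n. t p = 0" using ker t(1) unfolding trivial_kernel_def by blast
  moreover have "p \<in> region V 1 n" using p region_mono[of 1 i j n V] ij by auto
  ultimately show "s p = 0" using t(2)[OF p] by simp
qed

theorem corollary5p3:
  fixes V :: "nat \<Rightarrow> real ^ 2" and A :: "(real ^ 2) set" and n k :: nat
  assumes "is_strip V n"
    and "exact V 1 n A"
    and "1 \<le> k" and "k + 2 \<le> n"
    and "basic_212B V k (nodes_in A V k (k + 2))"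
  shows "(no_inner_side_nodes V n k A \<longrightarrow> (poised V 1 n A \<longleftrightarrow> reduced_exact_poised V n k A)) \<and>
         (reduced_exact_poised V n k A \<longrightarrow> poised V 1 n A)"
proof -
  note strip = assms(1) and k = assms(3,4) and basic = assms(5)
  have A: "finite A" "A \<subseteq> region V 1 n" "card A = n + 2"
    using assms(2) by (auto simp: exact_def)
  define L where "L = nodes_in A V 1 (k - 1) \<union> {V k, V (k + 1)}"
  define R where "R = nodes_in A V (k + 3) n \<union> {V (k + 3), V (k + 4)}"
  have regs: "region V 1 n = region V 1 (k - 1) \<union> region V k (k + 2) \<union> region V (k + 3) n"
    using region_split[of 1 "k - 1" n V] region_split[of k "k + 2" n V] k
    by (auto simp: numeral_3_eq_3)
  have LR: "L \<subseteq> region V 1 (k - 1)" if "1 < k"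
    using that vertex_in_region[of 1 "k - 1" k V] vertex_in_region[of 1 "k - 1" "k + 1" V]
    by (auto simp: L_def nodes_in_def)
  have RR: "R \<subseteq> region V (k + 3) n" if "k + 2 < n"
    using that vertex_in_region[of "k + 3" n "k + 3" V] vertex_in_region[of "k + 3" n "k + 4" V]
    by (auto simp: R_def nodes_in_def)
  have fin: "finite L" "finite R" using A(1) by (auto simp: L_def R_def nodes_in_def)
  have red: "reduced_exact_poised V n k A \<longleftrightarrow>
      (1 < k \<longrightarrow> exact V 1 (k - 1) L \<and> poised V 1 (k - 1) L) \<and>
      (k + 2 < n \<longrightarrow> exact V (k + 3) n R \<and> poised V (k + 3) n R)"
    unfolding reduced_exact_poised_def L_def R_def by simp
  \<comment> \<open>Both reduced kernels being trivial, so is the kernel of the whole problem.\<close>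
  have from_reduced: "poised V 1 n A" if r: "reduced_exact_poised V n k A"
  proof (rule trivial_kernel_imp_poised[OF strip _ _ _ assms(2)])
    show "trivial_kernel V 1 n A"
      unfolding trivial_kernel_def
    proof (intro ballI impI)
      fix s p assume s: "s \<in> spline_space V 1 n" "\<forall>a\<in>A. s a = 0" and p: "p \<in> region V 1 n"
      have vz: "s (V m) = 0" if "k \<le> m" "m \<le> k + 4" for m
        using basic_212B_zero[OF s(1) k basic _ that] s(2) by (auto simp: nodes_in_def)
      consider "p \<in> region V 1 (k - 1)" | "p \<in> region V k (k + 2)" | "p \<in> region V (k + 3) n"
        using p regs by auto
      then show "s p = 0"
      proof cases
        case 1
        then have k1: "1 < k" by (auto simp: region_def)
        then have "trivial_kernel V 1 (k - 1) L"
          using r LR unfolding red by (auto intro: poised_imp_trivial_kernel)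
        then show ?thesis
          using spline_zero_on_substrip[of V 1 "k - 1" A k "k + 1" s n p] s vz 1 LR[OF k1] k
          by (simp add: L_def)
      next
        case 2
        then obtain m where m: "k \<le> m" "m \<le> k + 2" "p \<in> tri V m" by (auto simp: region_def)
        have "s p = restrict (\<lambda>_. 0) (region V 1 n) p"
        proof (rule spline_eq_on_tri[OF s(1) _ _ spline_zero _ _ _ m(3)])
          show "1 \<le> m" "m \<le> n" "1 \<le> m" "m \<le> n" using m k by auto
          show "s (V v) = restrict (\<lambda>_. 0) (region V 1 n) (V v)" if "m \<le> v" "v \<le> m + 2" for v
            using that m k vz[of v] vertex_in_region[of 1 n v V] by simp
        qed
        then show ?thesis using p by simp
      next
        case 3
        then have k1: "k + 2 < n" by (auto simp: region_def)
        then have "trivial_kernel V (k + 3) n R"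
          using r RR unfolding red by (auto intro: poised_imp_trivial_kernel)
        then show ?thesis
          using spline_zero_on_substrip[of V "k + 3" n A "k + 3" "k + 4" s n p] s vz 3 RR[OF k1] k
          by (simp add: R_def)
      qed
    qed
  qed (use k in auto)
  \<comment> \<open>The reduced kernels are trivial by extension by zero, and exactness follows by counting nodes.\<close>
  have to_reduced: "reduced_exact_poised V n k A"
    if inner: "no_inner_side_nodes V n k A" and po: "poised V 1 n A"
  proof -
    have ker: "trivial_kernel V 1 n A" using poised_imp_trivial_kernel[OF po A(2)] .
    have kL: "trivial_kernel V 1 (k - 1) L" if k1: "1 < k"
    proof (rule trivial_kernel_substrip[OF strip _ _ _ ker A(2)])
      show "V v \<in> L" if "1 \<le> m" "m \<le> n" "\<not> (1 \<le> m \<and> m \<le> k - 1)" "m \<le> v" "v \<le> m + 2"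
         "1 \<le> v" "v \<le> k - 1 + 2" for m v
      proof -
        have "v = k \<or> v = k + 1" using that k1 by linarith
        then show ?thesis by (auto simp: L_def)
      qed
    qed (use k k1 in \<open>auto simp: L_def\<close>)
    have kR: "trivial_kernel V (k + 3) n R" if k1: "k + 2 < n"
    proof (rule trivial_kernel_substrip[OF strip _ _ _ ker A(2)])
      show "V v \<in> R" if "1 \<le> m" "m \<le> n" "\<not> (k + 3 \<le> m \<and> m \<le> n)" "m \<le> v" "v \<le> m + 2"
         "k + 3 \<le> v" "v \<le> n + 2" for m v
      proof -
        have "v = k + 3 \<or> v = k + 4" using that k1 by linarith
        then show ?thesis by (auto simp: R_def)
      qed
    qed (use k k1 in \<open>auto simp: R_def\<close>)
    define X where "X = nodes_in A V 1 (k - 1) - {V k, V (k + 1)}"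
    define Y where "Y = nodes_in A V (k + 3) n - {V (k + 3), V (k + 4)}"
    define B where "B = nodes_in A V k (k + 2)"
    have finXY: "finite X" "finite Y" "finite B"
      using A(1) by (auto simp: X_def Y_def B_def nodes_in_def)
    have distinct_side: "V m \<noteq> V (m + 1)" if "1 \<le> m" "m \<le> n" for m
    proof
      assume "V m = V (m + 1)"
      moreover have "\<not> collinear {V m, V (m + 1), V (m + 2)}"
        using strip that unfolding is_strip_def by blast
      ultimately show False by simp
    qed
    have "L = X \<union> {V k, V (k + 1)}" by (auto simp: L_def X_def)
    then have cL: "card L = card X + 2"
      using finXY(1) distinct_side[of k] k by (auto simp: X_def card_insert_if)
    have "V (k + 3) \<noteq> V (k + 4)" if "k + 2 < n"
      using distinct_side[of "k + 3"] that by (simp add: add.commute)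
    moreover have "R = Y \<union> {V (k + 3), V (k + 4)}" by (auto simp: R_def Y_def)
    ultimately have cR: "card R = card Y + 2" if "k + 2 < n"
      using finXY(2) that by (auto simp: Y_def card_insert_if)
    \<comment> \<open>A common node would lie on the shared side, and as it is not an end point, in its interior.\<close>
    have dXB: "X \<inter> B = {}"
    proof (rule ccontr)
      assume "X \<inter> B \<noteq> {}"
      then obtain a where a: "a \<in> X" "a \<in> B" by auto
      then have "a \<in> A" "a \<in> region V 1 (k - 1)" "a \<in> region V k (k + 2)"
        "a \<noteq> V k" "a \<noteq> V (k + 1)" by (auto simp: X_def B_def nodes_in_def)
      moreover from this have k1: "1 < k" by (auto simp: region_def)
      moreover have "region V 1 (k - 1) \<inter> region V k (k + 2) \<subseteq> closed_segment (V k) (V (k + 1))"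
        using region_Int_region[OF strip, of 1 "k + 2" "k - 1"] k k1 by simp
      ultimately show False
        using inner unfolding no_inner_side_nodes_def open_segment_def by blast
    qed
    have dYB: "Y \<inter> B = {}"
    proof (rule ccontr)
      assume "Y \<inter> B \<noteq> {}"
      then obtain a where a: "a \<in> Y" "a \<in> B" by auto
      then have "a \<in> A" "a \<in> region V (k + 3) n" "a \<in> region V k (k + 2)"
        "a \<noteq> V (k + 3)" "a \<noteq> V (k + 4)" by (auto simp: Y_def B_def nodes_in_def)
      moreover from this have k1: "k + 2 < n" by (auto simp: region_def)
      moreover have "region V k (k + 2) \<inter> region V (k + 3) n
          \<subseteq> closed_segment (V (k + 3)) (V (k + 4))"
        using region_Int_region[OF strip, of k n "k + 2"] k k1 by (simp add: numeral_eq_Suc)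
      ultimately show False
        using inner unfolding no_inner_side_nodes_def open_segment_def by blast
    qed
    have dXY: "X \<inter> Y = {}"
    proof (rule ccontr)
      assume "X \<inter> Y \<noteq> {}"
      then obtain a where a: "a \<in> region V 1 (k - 1)" "a \<in> region V (k + 3) n"
        unfolding X_def Y_def nodes_in_def by blast
      obtain l where l: "1 \<le> l" "l \<le> k - 1" "a \<in> tri V l"
        using a(1) unfolding region_def by auto
      obtain m where m: "k + 3 \<le> m" "m \<le> n" "a \<in> tri V m"
        using a(2) unfolding region_def by auto
      have "l + 3 \<le> m" using l m by linarith
      then have "tri V l \<inter> tri V m = {}" using strip l m unfolding is_strip_def by blast
      then show False using l m by blast
    qed
    have VB: "V k \<in> region V k (k + 2)" "V (k + 1) \<in> region V k (k + 2)"
      "V (k + 3) \<in> region V k (k + 2)" "V (k + 4) \<in> region V k (k + 2)"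
      by (auto intro!: vertex_in_region)
    have "A = X \<union> Y \<union> B"
      using A(2) regs VB by (auto simp: X_def Y_def B_def nodes_in_def)
    moreover have "card (X \<union> Y \<union> B) = card X + card Y + card B"
      using finXY dXB dYB dXY by (subst card_Un_disjoint; (subst card_Un_disjoint)?) auto
    moreover have "card B = 5"
      using basic_212B_card[OF strip k] basic by (simp add: B_def)
    ultimately have sum: "card X + card Y = n - 3" using A(3) by simp
    have X: "k - 1 \<le> card X"
    proof (cases "1 < k")
      case True
      then have "1 \<le> k - 1" "k - 1 \<le> n" using k by auto
      from trivial_kernel_card[OF strip _ this fin(1) LR kL] True cL show ?thesis by simp
    qed simp
    have Y: "n - (k + 2) \<le> card Y"
    proof (cases "k + 2 < n")
      case True
      then have "1 \<le> k + 3" "k + 3 \<le> n" by auto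
      from trivial_kernel_card[OF strip this _ fin(2) RR kR] True cR show ?thesis by simp
    qed simp
    have cards: "card X = k - 1" "card Y = n - (k + 2)" using sum X Y k by linarith+
    have exL: "exact V 1 (k - 1) L" if "1 < k"
      using that fin LR cL cards by (simp add: exact_def)
    have exR: "exact V (k + 3) n R" if "k + 2 < n"
      using that fin RR cR cards by (simp add: exact_def)
    show ?thesis
      unfolding red using exL exR kL kR k by (auto intro!: trivial_kernel_imp_poised[OF strip])
  qed
  show ?thesis using from_reduced to_reduced by blast
qed

end
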